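(* For every $p\in\mathbb{H}$ and every real $r>0$, the $\sigma$-ball $\Sigma(p,r)=\{q\in\mathbb{H}:\sigma(p,q)<r\}$ is a domain of slice regularity.
   Context: $\mathbb{H}$ denotes the quaternions, $\mathbb{S}=\{q\in\mathbb{H}: q^2=-1\}$, $\mathbb{C}_I=\mathbb{R}+I\mathbb{R}$ for $I\in\mathbb{S}$, and $\Omega_I:=\Omega\cap\mathbb{C}_I$. The $\sigma$-distance on $\mathbb{H}$ is defined by $\sigma(q,p)=|q-p|$ if there is $I\in\mathbb{S}$ with $p,q\in\mathbb{C}_I$, and $\sigma(q,p)=\sqrt{(\mathrm{Re}(q-p))^2+(|\mathrm{Im}(q)|+|\mathrm{Im}(p)|)^2}$ otherwise. A set $\Omega\subset\mathbb{H}$ is slice-open if $\Omega_I$ is open in $\mathbb{C}_I$ for every $I\in\mathbb{S}$; slice-open sets form the slice topology on $\mathbb{H}$, and slice-connected means connected in this topology. A function $f:\Omega\to\mathbb{H}$ on a slice-open set is slice regular if for every $I\in\mathbb{S}$ the restriction $f|_{\Omega_I}$ has continuous partial derivatives and satisfies $\frac12\left(\frac{\partial}{\partial x}+I\frac{\partial}{\partial y}\right)f(x+yI)=0$ on $\Omega_I$. A slice-open set $\Omega\subset\mathbb{H}$ is a domain of slice regularity if there are no slice-open sets $\Omega_1,\Omega_2$ in $\mathbb{H}$ such that: (i) $\varnothing\neq\Omega_1\subset\Omega_2\cap\Omega$; (ii) $\Omega_2$ is slice-connected and not contained in $\Omega$; (iii) for every slice regular function $f$ on $\Omega$ there is a slice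 regular function $\widetilde f$ on $\Omega_2$ with $f=\widetilde f$ on $\Omega_1$. *)

theory Defs
  imports "HOL-Analysis.Analysis"
begin

section \<open>Quaternions\<close>

codatatype quat = Quat (qRe: real) (qI: real) (qJ: real) (qK: real)

lemma quat_eq_iff:
  "x = y \<longleftrightarrow> qRe x = qRe y \<and> qI x = qI y \<and> qJ x = qJ y \<and> qK x = qK y"
  by (auto intro: quat.expand)

instantiation quat :: ab_group_add
begin

primcorec zero_quat where
  "qRe 0 = 0" | "qI 0 = 0" | "qJ 0 = 0" | "qK 0 = 0"

primcorec plus_quat where
  "qRe (x + y) = qRe x + qRe y"
| "qI (x + y) = qI x + qI y"
| "qJ (x + y) = qJ x + qJ y"
| "qK (x + y) = qK x + qK y"

primcorec uminus_quat where
  "qRe (- x) = - qRe x"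
| "qI (- x) = - qI x"
| "qJ (- x) = - qJ x"
| "qK (- x) = - qK x"

primcorec minus_quat where
  "qRe (x - y) = qRe x - qRe y"
| "qI (x - y) = qI x - qI y"
| "qJ (x - y) = qJ x - qJ y"
| "qK (x - y) = qK x - qK y"

instance
  by standard (simp_all add: quat_eq_iff)

end

instantiation quat :: ring_1
begin

primcorec one_quat where
  "qRe 1 = 1" | "qI 1 = 0" | "qJ 1 = 0" | "qK 1 = 0"

primcorec times_quat where
  "qRe (x * y) = qRe x * qRe y - qI x * qI y - qJ x * qJ y - qK x * qK y"
| "qI (x * y) = qRe x * qI y + qI x * qRe y + qJ x * qK y - qK x * qJ y"
| "qJ (x * y) = qRe x * qJ y - qI x * qK y + qJ x * qRe y + qK x * qI y"
| "qK (x * y) = qRe x * qK y + qI x * qJ y - qJ x * qI y + qK x * qRe y"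

instance
  by standard (simp_all add: quat_eq_iff algebra_simps)

end

instantiation quat :: real_algebra_1
begin

primcorec scaleR_quat where
  "qRe (scaleR r x) = r * qRe x"
| "qI (scaleR r x) = r * qI x"
| "qJ (scaleR r x) = r * qJ x"
| "qK (scaleR r x) = r * qK x"

instance
  by standard (simp_all add: quat_eq_iff algebra_simps)

end

instantiation quat :: real_div_algebra
begin

primcorec inverse_quat where
  "qRe (inverse x) = qRe x / ((qRe x)\<^sup>2 + (qI x)\<^sup>2 + (qJ x)\<^sup>2 + (qK x)\<^sup>2)"
| "qI (inverse x) = - qI x / ((qRe x)\<^sup>2 + (qI x)\<^sup>2 + (qJ x)\<^sup>2 + (qK x)\<^sup>2)"
| "qJ (inverse x) = - qJ x / ((qRe x)\<^sup>2 + (qI x)\<^sup>2 + (qJ x)\<^sup>2 + (qK x)\<^sup>2)"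
| "qK (inverse x) = - qK x / ((qRe x)\<^sup>2 + (qI x)\<^sup>2 + (qJ x)\<^sup>2 + (qK x)\<^sup>2)"

definition divide_quat_def: "x div y = x * inverse y" for x y :: quat

instance
proof
  fix x y :: quat
  let ?s = "(qRe x)\<^sup>2 + (qI x)\<^sup>2 + (qJ x)\<^sup>2 + (qK x)\<^sup>2"
  show "inverse 0 = (0 :: quat)"
    by (simp add: quat_eq_iff)
  show "x div y = x * inverse y"
    by (fact divide_quat_def)
  assume "x \<noteq> 0"
  then have s: "?s \<noteq> 0"
    by (simp add: quat_eq_iff add_nonneg_eq_0_iff)
  define t where "t = inverse ?s"
  have t: "?s * t = 1"
    using s unfolding t_def by (rule right_inverse)
  have i: "qRe (inverse x) = qRe x * t" "qI (inverse x) = - (qI x * t)"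
    "qJ (inverse x) = - (qJ x * t)" "qK (inverse x) = - (qK x * t)"
    by (simp_all add: t_def divide_inverse)
  show "inverse x * x = 1" "x * inverse x = 1"
    unfolding quat_eq_iff times_quat.sel one_quat.sel i
    using t by (simp_all add: power2_eq_square algebra_simps)
qed

end

instantiation quat :: real_inner
begin

definition inner_quat_def:
  "inner x y = qRe x * qRe y + qI x * qI y + qJ x * qJ y + qK x * qK y"

definition norm_quat_def:
  "norm x = sqrt ((qRe x)\<^sup>2 + (qI x)\<^sup>2 + (qJ x)\<^sup>2 + (qK x)\<^sup>2)"

definition sgn_quat_def: "sgn x = x /\<^sub>R norm x" for x :: quat

definition dist_quat_def: "dist x y = norm (x - y)" for x y :: quat

definition uniformity_quat_def [code del]:
  "(uniformity :: (quat \<times> quat) filter) = (INF e\<in>{0 <..}. principal {(x, y). dist x y < e})"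

definition open_quat_def [code del]:
  "open (U :: quat set) \<longleftrightarrow> (\<forall>x\<in>U. eventually (\<lambda>(x', y). x' = x \<longrightarrow> y \<in> U) uniformity)"

instance
proof
  fix x y z :: quat and r :: real
  show "inner x x = 0 \<longleftrightarrow> x = 0"
    by (simp add: inner_quat_def quat_eq_iff add_nonneg_eq_0_iff)
  show "norm x = sqrt (inner x x)"
    by (simp add: norm_quat_def inner_quat_def power2_eq_square)
qed (simp_all add: inner_quat_def sgn_quat_def dist_quat_def uniformity_quat_def open_quat_def
       algebra_simps)

end

instance quat :: real_normed_div_algebra
proof
  fix x y :: quat
  show "norm (x * y) = norm x * norm y"
    unfolding norm_quat_def times_quat.sel real_sqrt_mult [symmetric]
    by (rule arg_cong [where f = sqrt]) (simp add: power2_eq_square algebra_simps)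
qed

instantiation quat :: euclidean_space
begin

definition Basis_quat_def:
  "Basis = {Quat 1 0 0 0, Quat 0 1 0 0, Quat 0 0 1 0, Quat 0 0 0 1}"

instance
proof
  fix x :: quat
  show "(\<forall>b\<in>Basis. inner x b = 0) \<longleftrightarrow> x = 0"
    unfolding quat_eq_iff [of x] by (simp add: Basis_quat_def inner_quat_def)
qed (auto simp: Basis_quat_def inner_quat_def)

end

section \<open>Slices and the slice topology\<close>

definition qIm :: "quat \<Rightarrow> quat" where
  "qIm q = q - of_real (qRe q)"

definition imag_units :: "quat set"  (\<open>\<S>\<close>) where
  "\<S> = {q. q\<^sup>2 = - 1}"

definition slice :: "quat \<Rightarrow> quat set" where
  "slice I = {of_real x + of_real y * I | x y. True}"

definition sigma_dist :: "quat \<Rightarrow> quat \<Rightarrow> real" where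
  "sigma_dist q p =
     (if \<exists>I\<in>\<S>. p \<in> slice I \<and> q \<in> slice I then norm (q - p)
      else sqrt ((qRe (q - p))\<^sup>2 + (norm (qIm q) + norm (qIm p))\<^sup>2))"

definition sigma_ball :: "quat \<Rightarrow> real \<Rightarrow> quat set" where
  "sigma_ball p r = {q. sigma_dist p q < r}"

definition slice_open :: "quat set \<Rightarrow> bool" where
  "slice_open \<Omega> \<longleftrightarrow> (\<forall>I\<in>\<S>. openin (top_of_set (slice I)) (\<Omega> \<inter> slice I))"

lemma istopology_slice_open: "istopology slice_open"
  unfolding istopology_def
proof (intro conjI allI impI)
  fix A B assume "slice_open A" "slice_open B"
  moreover have "A \<inter> B \<inter> slice I = (A \<inter> slice I) \<inter> (B \<inter> slice I)" for I by blast
  ultimately show "slice_open (A \<inter> B)"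
    unfolding slice_open_def by (metis openin_Int)
next
  fix \<A> assume "\<forall>A\<in>\<A>. slice_open A"
  moreover have "\<Union>\<A> \<inter> slice I = (\<Union>A\<in>\<A>. A \<inter> slice I)" for I by blast
  ultimately show "slice_open (\<Union>\<A>)"
    unfolding slice_open_def by (simp only:) (rule ballI, rule openin_Union, auto)
qed

definition slice_topology :: "quat topology" where
  "slice_topology = topology slice_open"

lemma openin_slice_topology: "openin slice_topology \<Omega> \<longleftrightarrow> slice_open \<Omega>"
  by (simp add: slice_topology_def istopology_slice_open)

definition slice_connected :: "quat set \<Rightarrow> bool" where
  "slice_connected \<Omega> \<longleftrightarrow> connectedin slice_topology \<Omega>"

section \<open>Slice regular functions and domains of slice regularity\<close>

text \<open>
  A function on \<open>\<Omega>\<close> is represented by a total function whose values outside \<open>\<Omega>\<close> are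
  irrelevant. The functions \<open>fx\<close> and \<open>fy\<close> are the partial derivatives of
  \<open>(x, y) \<mapsto> f (x + y I)\<close> on the open set \<open>slice_coords \<Omega> I\<close> of the plane.
\<close>

definition slice_coords :: "quat set \<Rightarrow> quat \<Rightarrow> (real \<times> real) set" where
  "slice_coords \<Omega> I = {(x, y). of_real x + of_real y * I \<in> \<Omega>}"

definition slice_regular_on :: "(quat \<Rightarrow> quat) \<Rightarrow> quat set \<Rightarrow> bool" where
  "slice_regular_on f \<Omega> \<longleftrightarrow>
     slice_open \<Omega> \<and>
     (\<forall>I\<in>\<S>. \<exists>fx fy :: real \<times> real \<Rightarrow> quat.
        continuous_on (slice_coords \<Omega> I) fx \<and>
        continuous_on (slice_coords \<Omega> I) fy \<and>
        (\<forall>(x, y) \<in> slice_coords \<Omega> I.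
           ((\<lambda>t. f (of_real t + of_real y * I)) has_vector_derivative fx (x, y)) (at x) \<and>
           ((\<lambda>t. f (of_real x + of_real t * I)) has_vector_derivative fy (x, y)) (at y) \<and>
           (1 / 2) *\<^sub>R (fx (x, y) + I * fy (x, y)) = 0))"

definition domain_of_slice_regularity :: "quat set \<Rightarrow> bool" where
  "domain_of_slice_regularity \<Omega> \<longleftrightarrow>
     slice_open \<Omega> \<and>
     \<not> (\<exists>\<Omega>\<^sub>1 \<Omega>\<^sub>2. slice_open \<Omega>\<^sub>1 \<and> slice_open \<Omega>\<^sub>2 \<and>
          \<Omega>\<^sub>1 \<noteq> {} \<and> \<Omega>\<^sub>1 \<subseteq> \<Omega>\<^sub>2 \<inter> \<Omega> \<and>
          slice_connected \<Omega>\<^sub>2 \<and> \<not> \<Omega>\<^sub>2 \<subseteq> \<Omega> \<and>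
          (\<forall>f. slice_regular_on f \<Omega> \<longrightarrow>
             (\<exists>g. slice_regular_on g \<Omega>\<^sub>2 \<and> (\<forall>q\<in>\<Omega>\<^sub>1. f q = g q))))"

end

theory Submission
  imports Defs "HOL-Complex_Analysis.Conformal_Mappings"
begin

text \<open>
  Write \<open>p = x\<^sub>0 + y\<^sub>0 I\<close> and \<open>z\<^sub>0 = x\<^sub>0 + i y\<^sub>0\<close>. In the coordinates of a slice, the \<open>\<sigma>\<close>-ball is the disc of
  radius \<open>r\<close> around \<open>z\<^sub>0\<close> (on \<open>\<complex>\<^sub>I\<close>), around its conjugate (on \<open>\<complex>\<^sub>-\<^sub>I\<close>), or the intersection of
  both discs (on all other slices); in particular its slices are convex. By the identity theorem
  the set on which all functions on \<open>\<Omega>\<close> coincide with their continuations to \<open>\<Omega>\<^sub>2\<close>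
  spreads from \<open>\<Omega>\<^sub>1\<close> through the slice-connected set \<open>\<Omega>\<^sub>2\<close> until it accumulates at a boundary
  point of some slice of \<open>\<Omega>\<close>. There a regular function with a pole gives the contradiction: the
  \<open>*\<close>-inverse of \<open>q - w\<close>, where \<open>w\<close> lies on the circle bounding the disc in \<open>\<complex>\<^sub>I\<close> and on the
  sphere of the boundary point.
\<close>

section \<open>Slices as copies of the complex plane\<close>

definition slice_embed :: "quat \<Rightarrow> complex \<Rightarrow> quat" where
  "slice_embed J z = of_real (Re z) + of_real (Im z) * J"

lemma of_real_quat_sel [simp]:
  "qRe (of_real x) = x" "qI (of_real x) = 0" "qJ (of_real x) = 0" "qK (of_real x) = 0"
  by (simp_all add: of_real_def)

text \<open>The imaginary components of \<open>J * J\<close> are twice \<open>qRe J\<close> times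
  those of \<open>J\<close>. A nonzero real part would thus make \<open>J\<close> a real number with
  square -1.\<close>

lemma imag_units_iff: "J \<in> \<S> \<longleftrightarrow> qRe J = 0 \<and> (qI J)\<^sup>2 + (qJ J)\<^sup>2 + (qK J)\<^sup>2 = 1"
proof
  assume "J \<in> \<S>"
  then have *: "qRe (J * J) = -1" "qI (J * J) = 0" "qJ (J * J) = 0" "qK (J * J) = 0"
    by (simp_all add: imag_units_def power2_eq_square)
  have "qRe J = 0"
  proof (rule ccontr)
    assume "qRe J \<noteq> 0"
    with *(2-4) have "qI J = 0" "qJ J = 0" "qK J = 0" by (auto simp: algebra_simps)
    with *(1) have "(qRe J)\<^sup>2 = -1" by (simp add: power2_eq_square)
    then show False using zero_le_power2 [of "qRe J"] by linarith
  qed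
  with * show "qRe J = 0 \<and> (qI J)\<^sup>2 + (qJ J)\<^sup>2 + (qK J)\<^sup>2 = 1"
    by (simp add: power2_eq_square)
qed (simp add: imag_units_def power2_eq_square quat_eq_iff)

lemma imag_units_square: "J \<in> \<S> \<Longrightarrow> J * J = -1"
  by (simp add: imag_units_def power2_eq_square)

lemma imag_units_uminus: "J \<in> \<S> \<Longrightarrow> - J \<in> \<S>"
  by (simp add: imag_units_def)

lemma norm_imag_units: "J \<in> \<S> \<Longrightarrow> norm J = 1"
  by (simp add: imag_units_iff norm_quat_def)

lemma slice_embed_of_real [simp]: "slice_embed J (of_real x) = of_real x"
  by (simp add: slice_embed_def)

lemma slice_embed_0 [simp]: "slice_embed J 0 = 0"
  and slice_embed_1 [simp]: "slice_embed J 1 = 1"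
  by (simp_all add: slice_embed_def)

lemma slice_embed_add: "slice_embed J (z + w) = slice_embed J z + slice_embed J w"
  and slice_embed_diff: "slice_embed J (z - w) = slice_embed J z - slice_embed J w"
  by (simp_all add: slice_embed_def algebra_simps)

text \<open>\<open>J\<close> and \<open>- J\<close> give the same slice with opposite orientations,
  so each slice carries two conjugate coordinates.\<close>

lemma slice_embed_uminus: "slice_embed (- J) z = slice_embed J (cnj z)"
  by (simp add: slice_embed_def)

lemma slice_embed_real: "Im z = 0 \<Longrightarrow> slice_embed J z = of_real (Re z)"
  by (simp add: slice_embed_def)

lemma slice_embed_mult:
  assumes "J \<in> \<S>"
  shows "slice_embed J (z * w) = slice_embed J z * slice_embed J w"
proof -
  have "slice_embed J z * slice_embed J w =
      of_real (Re z * Re w) + of_real (Re z * Im w + Im z * Re w) * J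
      + of_real (Im z * Im w) * (J * J)"
    by (simp add: slice_embed_def of_real_def algebra_simps)
  then show ?thesis
    using assms by (simp add: imag_units_square slice_embed_def algebra_simps)
qed

lemma slice_embed_inverse:
  assumes "J \<in> \<S>"
  shows "slice_embed J (inverse z) = inverse (slice_embed J z)"
proof (cases "z = 0")
  case False
  then have "slice_embed J (inverse z) * slice_embed J z = 1"
    by (simp flip: slice_embed_mult [OF assms])
  then show ?thesis
    by (metis inverse_unique inverse_inverse_eq)
qed simp

lemma norm_slice_embed:
  assumes "J \<in> \<S>"
  shows "norm (slice_embed J z) = cmod z"
proof -
  have "(Im z * qI J)\<^sup>2 + (Im z * qJ J)\<^sup>2 + (Im z * qK J)\<^sup>2
      = (Im z)\<^sup>2 * ((qI J)\<^sup>2 + (qJ J)\<^sup>2 + (qK J)\<^sup>2)"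
    by (simp add: power_mult_distrib algebra_simps)
  then have "(Im z * qI J)\<^sup>2 + (Im z * qJ J)\<^sup>2 + (Im z * qK J)\<^sup>2 = (Im z)\<^sup>2"
    using assms by (simp add: imag_units_iff)
  then show ?thesis
    using assms by (simp add: norm_quat_def slice_embed_def imag_units_iff cmod_def add.assoc)
qed

lemma dist_slice_embed: "J \<in> \<S> \<Longrightarrow> dist (slice_embed J z) (slice_embed J w) = dist z w"
  by (simp add: dist_norm norm_slice_embed flip: slice_embed_diff)

lemma slice_embed_eq_iff: "J \<in> \<S> \<Longrightarrow> slice_embed J z = slice_embed J w \<longleftrightarrow> z = w"
  by (metis dist_eq_0_iff dist_slice_embed)

lemma bounded_linear_slice_embed: "J \<in> \<S> \<Longrightarrow> bounded_linear (slice_embed J)"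
  by (rule bounded_linear_intro [where K = 1])
    (simp_all add: slice_embed_add norm_slice_embed, simp add: slice_embed_def of_real_def algebra_simps)

lemmas continuous_on_slice_embed [continuous_intros] =
  bounded_linear.continuous_on [OF bounded_linear_slice_embed]

lemma slice_eq_range: "slice J = range (slice_embed J)"
proof -
  have *: "of_real x + of_real y * J = slice_embed J (Complex x y)" for x y
    by (simp add: slice_embed_def)
  show ?thesis
    unfolding slice_def * by (auto intro: exI [of _ "Re _"]) (metis complex_surj)
qed

lemma slice_embed_sel:
  assumes "J \<in> \<S>"
  shows "qRe (slice_embed J z) = Re z" "norm (qIm (slice_embed J z)) = \<bar>Im z\<bar>"
proof -
  show *: "qRe (slice_embed J z) = Re z"
    using assms by (simp add: slice_embed_def imag_units_iff)
  show "norm (qIm (slice_embed J z)) = \<bar>Im z\<bar>"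
    unfolding qIm_def * using assms by (simp add: slice_embed_def norm_mult norm_imag_units)
qed

text \<open>The real part and the norm of the imaginary part are intrinsic to a quaternion, so the
  coordinates agree up to conjugation; off the real axis the factor \<open>Im z\<close> cancels and
  fixes the unit up to sign.\<close>

lemma slice_embed_eq_cases:
  assumes "J \<in> \<S>" "K \<in> \<S>" "slice_embed J z = slice_embed K w"
  obtains "Im z = 0" "w = z" | "J = K" "w = z" | "J = - K" "w = cnj z"
proof -
  have re: "Re z = Re w" and im: "\<bar>Im z\<bar> = \<bar>Im w\<bar>"
    using assms slice_embed_sel by metis+
  show thesis
  proof (cases "Im z = 0")
    case True
    then show thesis using re im that(1) by (simp add: complex_eq_iff)
  next
    case False
    consider "Im w = Im z" | "Im w = - Im z" using im by linarith
    then show thesis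
    proof cases
      case 1
      then have "of_real (Im z) * J = of_real (Im z) * K"
        using assms(3) re by (simp add: slice_embed_def)
      then show thesis using that(2) False 1 re by (simp add: complex_eq_iff)
    next
      case 2
      then have "of_real (Im z) * J = of_real (Im z) * (- K)"
        using assms(3) re by (simp add: slice_embed_def)
      then have "J = - K" using False mult_left_cancel [of "of_real (Im z)" J "- K"] by simp
      then show thesis using that(3) 2 re by (simp add: complex_eq_iff)
    qed
  qed
qed

text \<open>Normalising the imaginary part yields the unit. A real quaternion lies on every slice,
  so any fixed unit serves.\<close>

lemma ex_slice_embed:
  obtains J z where "J \<in> \<S>" "q = slice_embed J z" "Im z \<ge> 0"
proof (cases "qIm q = 0")
  case True
  have "Quat 0 1 0 0 \<in> \<S>" by (simp add: imag_units_iff)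
  moreover have "q = slice_embed (Quat 0 1 0 0) (of_real (qRe q))"
    using True by (simp add: qIm_def)
  ultimately show thesis using that by fastforce
next
  case False
  define J where "J = qIm q /\<^sub>R norm (qIm q)"
  have re: "qRe (qIm q) = 0" by (simp add: qIm_def)
  then have n: "(norm (qIm q))\<^sup>2 = (qI (qIm q))\<^sup>2 + (qJ (qIm q))\<^sup>2 + (qK (qIm q))\<^sup>2"
    by (simp add: norm_quat_def)
  have "J \<in> \<S>"
    using False unfolding imag_units_iff J_def
    by (simp add: re power_mult_distrib flip: n distrib_left) (simp add: field_simps)
  moreover have "q = slice_embed J (Complex (qRe q) (norm (qIm q)))"
  proof -
    have "of_real (norm (qIm q)) * J = qIm q"
      using False by (simp add: J_def of_real_def)
    then show ?thesis by (simp add: slice_embed_def qIm_def)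
  qed
  ultimately show thesis using that by fastforce
qed

section \<open>Slice-openness and slice regularity in complex coordinates\<close>

lemma slice_open_iff: "slice_open \<Omega> \<longleftrightarrow> (\<forall>J\<in>\<S>. open (slice_embed J -` \<Omega>))"
proof -
  have "openin (top_of_set (slice J)) (\<Omega> \<inter> slice J) \<longleftrightarrow> open (slice_embed J -` \<Omega>)"
    if "J \<in> \<S>" for J
  proof -
    have "openin (top_of_set (slice J)) (\<Omega> \<inter> slice J) \<longleftrightarrow>
        (\<forall>z. slice_embed J z \<in> \<Omega> \<longrightarrow>
          (\<exists>e>0. \<forall>w. dist (slice_embed J w) (slice_embed J z) < e \<longrightarrow> slice_embed J w \<in> \<Omega>))"
      unfolding openin_euclidean_subtopology_iff slice_eq_range by blast
    then show ?thesis
      by (auto simp: dist_slice_embed [OF that] open_dist)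
  qed
  then show ?thesis by (simp add: slice_open_def)
qed

text \<open>Continuous partial derivatives give a total derivative, and the Cauchy-Riemann equation
  makes it commute with left multiplication by \<open>J\<close>; it is then determined by its value
  \<open>D z\<close> at 1.\<close>

lemma slice_regular_on_iff:
  "slice_regular_on f \<Omega> \<longleftrightarrow> slice_open \<Omega> \<and>
     (\<forall>J\<in>\<S>. \<exists>D. continuous_on (slice_embed J -` \<Omega>) D \<and>
        (\<forall>z\<in>slice_embed J -` \<Omega>.
           ((\<lambda>z. f (slice_embed J z)) has_derivative (\<lambda>h. slice_embed J h * D z)) (at z)))"
    (is "_ \<longleftrightarrow> _ \<and> (\<forall>J\<in>\<S>. ?R J)")
proof -
  let ?L = "\<lambda>J. \<exists>fx fy :: real \<times> real \<Rightarrow> quat.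
        continuous_on (slice_coords \<Omega> J) fx \<and>
        continuous_on (slice_coords \<Omega> J) fy \<and>
        (\<forall>(x, y) \<in> slice_coords \<Omega> J.
           ((\<lambda>t. f (of_real t + of_real y * J)) has_vector_derivative fx (x, y)) (at x) \<and>
           ((\<lambda>t. f (of_real x + of_real t * J)) has_vector_derivative fy (x, y)) (at y) \<and>
           (1 / 2) *\<^sub>R (fx (x, y) + J * fy (x, y)) = 0)"
  have coords: "slice_coords \<Omega> J = (\<lambda>(x, y). Complex x y) -` slice_embed J -` \<Omega>" for J
    by (auto simp: slice_coords_def slice_embed_def)
  have contC: "continuous_on S (\<lambda>p. Complex (fst p) (snd p))" for S :: "(real \<times> real) set"
    unfolding Complex_eq by (intro continuous_intros)
  have "?R J" if J: "J \<in> \<S>" and op: "open (slice_embed J -` \<Omega>)" and "?L J" for J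
  proof -
    obtain fx fy where cx: "continuous_on (slice_coords \<Omega> J) fx"
      and cy: "continuous_on (slice_coords \<Omega> J) fy"
      and dx: "\<And>x y. (x, y) \<in> slice_coords \<Omega> J \<Longrightarrow>
           ((\<lambda>t. f (of_real t + of_real y * J)) has_vector_derivative fx (x, y)) (at x)"
      and dy: "\<And>x y. (x, y) \<in> slice_coords \<Omega> J \<Longrightarrow>
           ((\<lambda>t. f (of_real x + of_real t * J)) has_vector_derivative fy (x, y)) (at y)"
      and cr: "\<And>x y. (x, y) \<in> slice_coords \<Omega> J \<Longrightarrow> fx (x, y) + J * fy (x, y) = 0"
      using \<open>?L J\<close> by fastforce
    define D where "D z = fx (Re z, Im z)" for z
    have "continuous_on (slice_embed J -` \<Omega>) D"
      unfolding D_def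
      by (rule continuous_on_compose2 [OF cx]) (auto intro!: continuous_intros simp: coords)
    moreover have "((\<lambda>z. f (slice_embed J z)) has_derivative (\<lambda>h. slice_embed J h * D z)) (at z)"
      if z: "z \<in> slice_embed J -` \<Omega>" for z
    proof -
      have opc: "open (slice_coords \<Omega> J)"
        unfolding coords by (intro open_vimage op) (use contC in \<open>simp add: case_prod_unfold\<close>)
      have zc: "(Re z, Im z) \<in> slice_coords \<Omega> J" using z by (simp add: coords)
      obtain X Y where XY: "open X" "open Y" "Re z \<in> X" "Im z \<in> Y" "X \<times> Y \<subseteq> slice_coords \<Omega> J"
        using open_prod_elim [OF opc zc] by (metis mem_Sigma_iff)
      obtain e where e: "e > 0" "ball (Im z) e \<subseteq> Y" using XY open_contains_ball by metis
      let ?Y = "ball (Im z) e"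
      have sub: "X \<times> ?Y \<subseteq> slice_coords \<Omega> J" using XY e by blast
      have "((\<lambda>(x, y). f (of_real x + of_real y * J)) has_derivative
          (\<lambda>(tx, ty). tx *\<^sub>R fx (Re z, Im z)
              + blinfun_apply (blinfun_scaleR_left (fy (Re z, Im z))) ty))
          (at (Re z, Im z) within X \<times> ?Y)"
      \<comment> \<open>This rule asks for a convex second factor and for the second partial
        derivative as a continuous family of bounded operators; hence the ball \<open>?Y\<close> and
        \<open>blinfun_scaleR_left\<close>.\<close>
      proof (rule has_derivative_partialsI)
        show "((\<lambda>x. f (of_real x + of_real (Im z) * J)) has_derivative
            (\<lambda>tx. tx *\<^sub>R fx (Re z, Im z))) (at (Re z) within X)"
          using dx [OF zc] unfolding has_vector_derivative_def
          by (rule has_derivative_at_withinI)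
        show "((\<lambda>y. f (of_real x + of_real y * J)) has_derivative
            blinfun_apply (blinfun_scaleR_left (fy (x, y)))) (at y within ?Y)"
          if "x \<in> X" "y \<in> ?Y" for x y
        proof -
          have "(x, y) \<in> slice_coords \<Omega> J" using that sub by blast
          from dy [OF this] show ?thesis
            unfolding has_vector_derivative_def blinfun_scaleR_left.rep_eq
            by (rule has_derivative_at_withinI)
        qed
        have "continuous_on (X \<times> ?Y) (\<lambda>p. blinfun_scaleR_left (fy p))"
          by (intro bounded_linear.continuous_on [OF bounded_linear_blinfun_scaleR_left]
              continuous_on_subset [OF cy sub])
        then show "continuous (at (Re z, Im z) within X \<times> ?Y)
            (\<lambda>(x, y). blinfun_scaleR_left (fy (x, y)))"
          using XY e by (simp add: continuous_on_eq_continuous_within case_prod_unfold)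
      qed (use e in auto)
      then have "((\<lambda>(x, y). f (of_real x + of_real y * J)) has_derivative
          (\<lambda>(tx, ty). tx *\<^sub>R fx (Re z, Im z) + ty *\<^sub>R fy (Re z, Im z))) (at (Re z, Im z))"
        using XY e by (simp add: at_within_open [OF _ open_Times])
      moreover have "((\<lambda>z. (Re z, Im z)) has_derivative (\<lambda>h. (Re h, Im h))) (at z)"
        by (auto intro!: derivative_eq_intros)
      ultimately have "((\<lambda>(x, y). f (of_real x + of_real y * J)) \<circ> (\<lambda>z. (Re z, Im z))
          has_derivative (\<lambda>(tx, ty). tx *\<^sub>R fx (Re z, Im z) + ty *\<^sub>R fy (Re z, Im z))
            \<circ> (\<lambda>h. (Re h, Im h))) (at z)"
        by (intro diff_chain_at)
      \<comment> \<open>The Cauchy-Riemann equation multiplied by \<open>J\<close> from the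
        left.\<close>
      moreover have "J * fx (Re z, Im z) = fy (Re z, Im z)"
      proof -
        have "fx (Re z, Im z) = - (J * fy (Re z, Im z))"
          using cr [OF zc] by (simp add: eq_neg_iff_add_eq_0)
        then show ?thesis by (simp add: imag_units_square [OF J] flip: mult.assoc)
      qed
      ultimately show ?thesis
        by (simp add: o_def D_def slice_embed_def of_real_def algebra_simps)
    qed
    ultimately show ?thesis by blast
  qed
  moreover have "?L J" if J: "J \<in> \<S>" and "?R J" for J
  proof -
    obtain D where cD: "continuous_on (slice_embed J -` \<Omega>) D"
      and D: "\<And>z. z \<in> slice_embed J -` \<Omega> \<Longrightarrow>
        ((\<lambda>z. f (slice_embed J z)) has_derivative (\<lambda>h. slice_embed J h * D z)) (at z)"
      using \<open>?R J\<close> by blast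
    define fx where "fx p = D (Complex (fst p) (snd p))" for p
    have cx: "continuous_on (slice_coords \<Omega> J) fx"
      unfolding fx_def
      by (rule continuous_on_compose2 [OF cD contC]) (auto simp: coords)
    have "((\<lambda>t. f (of_real t + of_real y * J)) has_vector_derivative fx (x, y)) (at x)"
      "((\<lambda>t. f (of_real x + of_real t * J)) has_vector_derivative J * fx (x, y)) (at y)"
      if "(x, y) \<in> slice_coords \<Omega> J" for x y
    proof -
      have d: "((\<lambda>z. f (slice_embed J z)) has_derivative (\<lambda>h. slice_embed J h * fx (x, y)))
          (at (Complex x y))"
        using D [of "Complex x y"] that by (simp add: coords fx_def)
      have "((\<lambda>t. Complex t y) has_derivative (\<lambda>h. of_real h)) (at x)"
        unfolding Complex_eq by (auto intro!: derivative_eq_intros)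
      from diff_chain_at [OF this d]
      show "((\<lambda>t. f (of_real t + of_real y * J)) has_vector_derivative fx (x, y)) (at x)"
        by (simp add: o_def has_vector_derivative_def slice_embed_def) (simp add: of_real_def)
      have "((\<lambda>t. Complex x t) has_derivative (\<lambda>h. \<i> * of_real h)) (at y)"
        unfolding Complex_eq by (auto intro!: derivative_eq_intros)
      from diff_chain_at [OF this d]
      show "((\<lambda>t. f (of_real x + of_real t * J)) has_vector_derivative J * fx (x, y)) (at y)"
        by (simp add: o_def has_vector_derivative_def slice_embed_def) (simp add: of_real_def)
    qed
    moreover have "fx p + J * (J * fx p) = 0" for p
      by (simp add: imag_units_square [OF J] flip: mult.assoc)
    ultimately show ?thesis
      using cx by (intro exI [of _ fx] exI [of _ "\<lambda>p. J * fx p"]) (auto intro: continuous_intros)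
  qed
  ultimately have "slice_open \<Omega> \<Longrightarrow> J \<in> \<S> \<Longrightarrow> ?L J \<longleftrightarrow> ?R J" for J
    using slice_open_iff by blast
  then show ?thesis
    unfolding slice_regular_on_def by blast
qed

section \<open>Identity theorem and a sufficient condition for regularity\<close>

text \<open>Composing the difference with a real-linear map to the complex numbers reduces the claim
  to the identity theorem for one holomorphic function. The map may depend on \<open>w\<close>,
  since only the value at \<open>w\<close> is claimed.\<close>

lemma slice_regular_identity:
  assumes f: "slice_regular_on f \<Omega>" and g: "slice_regular_on g \<Omega>'" and J: "J \<in> \<S>"
    and D: "open D" "connected D" "D \<subseteq> slice_embed J -` (\<Omega> \<inter> \<Omega>')"
    and U: "U \<subseteq> D" "\<xi> \<in> D" "\<xi> islimpt U"
    and eq: "\<And>z. z \<in> U \<Longrightarrow> f (slice_embed J z) = g (slice_embed J z)"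
    and w: "w \<in> D"
  shows "f (slice_embed J w) = g (slice_embed J w)"
proof -
  define \<delta> where "\<delta> z = f (slice_embed J z) - g (slice_embed J z)" for z
  \<comment> \<open>\<open>L\<close> turns left multiplication by \<open>J\<close> into multiplication by \<open>\<i>\<close>, so \<open>L \<circ> \<delta>\<close> is holomorphic.\<close>
  define L where "L q = Complex (q \<bullet> \<delta> w) (- ((J * q) \<bullet> \<delta> w))" for q
  have L_diff: "L (p - q) = L p - L q" for p q
    by (simp add: L_def complex_eq_iff algebra_simps)
  have L_mult: "L (slice_embed J h * q) = h * L q" for h q
  proof -
    have 1: "slice_embed J h * q = Re h *\<^sub>R q + Im h *\<^sub>R (J * q)"
      by (simp add: slice_embed_def of_real_def algebra_simps)
    have 2: "J * (slice_embed J h * q) = Re h *\<^sub>R (J * q) - Im h *\<^sub>R q"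
    proof -
      have "J * (J * q) = - q"
        by (simp add: imag_units_square [OF J] flip: mult.assoc)
      then show ?thesis by (simp add: slice_embed_def of_real_def algebra_simps)
    qed
    show ?thesis
      unfolding L_def 2 unfolding 1
      by (simp add: complex_eq_iff inner_add_left inner_diff_left algebra_simps)
  qed
  have L: "bounded_linear L"
  proof -
    have *: "L = (\<lambda>q. of_real (q \<bullet> \<delta> w) + \<i> * of_real (- ((J * q) \<bullet> \<delta> w)))"
      by (simp add: L_def fun_eq_iff complex_eq_iff)
    show ?thesis
      unfolding *
      by (intro bounded_linear_add bounded_linear_const_mult bounded_linear_compose [OF bounded_linear_of_real]
          bounded_linear_minus bounded_linear_inner_left
          bounded_linear_compose [OF bounded_linear_inner_left bounded_linear_mult_right])
  qed
  have "(\<lambda>z. L (\<delta> z)) holomorphic_on D"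
    unfolding holomorphic_on_def
  proof
    fix z assume "z \<in> D"
    then have "z \<in> slice_embed J -` \<Omega>" "z \<in> slice_embed J -` \<Omega>'" using D by auto
    then obtain a b where
      "((\<lambda>z. f (slice_embed J z)) has_derivative (\<lambda>h. slice_embed J h * a)) (at z)"
      "((\<lambda>z. g (slice_embed J z)) has_derivative (\<lambda>h. slice_embed J h * b)) (at z)"
      using f g J unfolding slice_regular_on_iff by meson
    from has_derivative_diff [OF this]
    have "(\<delta> has_derivative (\<lambda>h. slice_embed J h * (a - b))) (at z)"
      by (simp add: \<delta>_def [abs_def] right_diff_distrib)
    from bounded_linear.has_derivative [OF L this]
    have "((\<lambda>z. L (\<delta> z)) has_field_derivative L (a - b)) (at z)"
      by (simp add: L_mult has_field_derivative_def mult.commute [of _ "L _"])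
    then show "(\<lambda>z. L (\<delta> z)) field_differentiable at z within D"
      by (metis field_differentiable_at_within field_differentiable_def)
  qed
  then have "L (\<delta> w) = 0"
    by (rule analytic_continuation [OF _ D(1,2) U _ w])
      (simp add: eq \<delta>_def L_def complex_eq_iff)
  \<comment> \<open>The real part of \<open>L (\<delta> w)\<close> is the squared norm of
    \<open>\<delta> w\<close>.\<close>
  then have "\<delta> w = 0"
    by (simp add: L_def complex_eq_iff)
  then show ?thesis by (simp add: \<delta>_def)
qed

text \<open>Left multiplication by \<open>slice_embed J h\<close> commutes with right multiplication
  by the constant \<open>a\<close>, so holomorphic coefficients suffice. The form is that of the
  splitting of a regular function over a slice.\<close>

lemma slice_regular_onI:
  assumes "slice_open \<Omega>"
    and "\<And>J. J \<in> \<S> \<Longrightarrow> \<exists>u v a. u holomorphic_on slice_embed J -` \<Omega> \<and>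
      v holomorphic_on slice_embed J -` \<Omega> \<and>
      (\<forall>z\<in>slice_embed J -` \<Omega>. f (slice_embed J z) = slice_embed J (u z) + slice_embed J (v z) * a)"
  shows "slice_regular_on f \<Omega>"
  unfolding slice_regular_on_iff
proof (intro conjI ballI assms(1))
  fix J assume J: "J \<in> \<S>"
  then obtain u v a where
    u: "u holomorphic_on slice_embed J -` \<Omega>" and v: "v holomorphic_on slice_embed J -` \<Omega>" and
    f: "\<And>z. z \<in> slice_embed J -` \<Omega> \<Longrightarrow>
      f (slice_embed J z) = slice_embed J (u z) + slice_embed J (v z) * a"
    using assms(2) by meson
  let ?W = "slice_embed J -` \<Omega>"
  have W: "open ?W" using assms(1) J by (simp add: slice_open_iff)
  let ?D = "\<lambda>z. slice_embed J (deriv u z) + slice_embed J (deriv v z) * a"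
  show "\<exists>D. continuous_on ?W D \<and>
      (\<forall>z\<in>?W. ((\<lambda>z. f (slice_embed J z)) has_derivative (\<lambda>h. slice_embed J h * D z)) (at z))"
  proof (intro exI [of _ ?D] conjI ballI)
    show "continuous_on ?W ?D"
      by (intro continuous_intros continuous_on_slice_embed J holomorphic_on_imp_continuous_on
          holomorphic_deriv u v W)
    fix z assume z: "z \<in> ?W"
    note lin = bounded_linear.has_derivative [OF bounded_linear_slice_embed [OF J]]
    have "((\<lambda>z. slice_embed J (u z) + slice_embed J (v z) * a) has_derivative
        (\<lambda>h. slice_embed J (deriv u z * h) + slice_embed J (deriv v z * h) * a)) (at z)"
      using holomorphic_derivI [OF u W z] holomorphic_derivI [OF v W z]
      by (intro has_derivative_add has_derivative_mult_left lin)
        (simp_all add: has_field_derivative_def)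
    also have "(\<lambda>h. slice_embed J (deriv u z * h) + slice_embed J (deriv v z * h) * a)
        = (\<lambda>h. slice_embed J h * ?D z)"
      by (simp add: mult.commute [of "deriv _ _"] slice_embed_mult [OF J] algebra_simps)
    finally show "((\<lambda>z. f (slice_embed J z)) has_derivative (\<lambda>h. slice_embed J h * ?D z)) (at z)"
      by (rule has_derivative_transform_within_open [OF _ W z]) (simp add: f)
  qed
qed

section \<open>A criterion through functions singular at the frontier\<close>

text \<open>Convexity keeps the part of a slice inside a small disc connected, so agreement
  somewhere in that part extends to all of it. A function without a limit at the centre then cannot
  agree there with one continuous at the centre.\<close>

lemma domain_of_slice_regularityI:
  assumes op: "slice_open \<Omega>"
    and conv: "\<And>J. J \<in> \<S> \<Longrightarrow> convex (slice_embed J -` \<Omega>)"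
    and bdry: "\<And>J \<zeta>. J \<in> \<S> \<Longrightarrow> \<zeta> \<in> frontier (slice_embed J -` \<Omega>) \<Longrightarrow>
      \<exists>f. slice_regular_on f \<Omega> \<and>
        (\<forall>l. \<not> ((\<lambda>z. f (slice_embed J z)) \<longlongrightarrow> l) (at \<zeta> within slice_embed J -` \<Omega>))"
  shows "domain_of_slice_regularity \<Omega>"
  unfolding domain_of_slice_regularity_def
proof (intro conjI op notI)
  assume "\<exists>\<Omega>\<^sub>1 \<Omega>\<^sub>2. slice_open \<Omega>\<^sub>1 \<and> slice_open \<Omega>\<^sub>2 \<and>
          \<Omega>\<^sub>1 \<noteq> {} \<and> \<Omega>\<^sub>1 \<subseteq> \<Omega>\<^sub>2 \<inter> \<Omega> \<and>
          slice_connected \<Omega>\<^sub>2 \<and> \<not> \<Omega>\<^sub>2 \<subseteq> \<Omega> \<and>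
          (\<forall>f. slice_regular_on f \<Omega> \<longrightarrow>
             (\<exists>g. slice_regular_on g \<Omega>\<^sub>2 \<and> (\<forall>q\<in>\<Omega>\<^sub>1. f q = g q)))"
  then obtain P Q where P: "slice_open P" "P \<noteq> {}" "P \<subseteq> Q \<inter> \<Omega>"
    and Q: "slice_open Q" "slice_connected Q" "\<not> Q \<subseteq> \<Omega>"
    and ext: "\<And>f. slice_regular_on f \<Omega> \<Longrightarrow>
      \<exists>g. slice_regular_on g Q \<and> (\<forall>q\<in>P. f q = g q)"
    by metis
  \<comment> \<open>Agreement is demanded of all pairs \<open>f\<close>, \<open>g\<close> at once,
    so that the singular function can be chosen after the boundary point is known.\<close>
  define E where "E = {q \<in> Q \<inter> \<Omega>. \<forall>f g. slice_regular_on f \<Omega> \<longrightarrow> slice_regular_on g Q \<longrightarrow>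
      (\<forall>q\<in>P. f q = g q) \<longrightarrow> f q = g q}"
  \<comment> \<open>\<open>E\<close> need not be slice-open, but \<open>A\<close> is: by \<open>spread\<close>, whether a real point is interior to \<open>E\<close>
      does not depend on the slice.\<close>
  define A where "A = (\<Union>J\<in>\<S>. slice_embed J ` interior (slice_embed J -` E))"
  have open_Q: "open (slice_embed J -` Q)" and open_Om: "open (slice_embed J -` \<Omega>)"
    and open_P: "open (slice_embed J -` P)" if "J \<in> \<S>" for J
    using that P(1) Q(1) op by (simp_all add: slice_open_iff)
  \<comment> \<open>The identity theorem for all pairs simultaneously: agreement accumulating in a
    connected open \<open>D\<close> fills \<open>D\<close>.\<close>
  have spread: "D \<subseteq> slice_embed J -` E"
    if "J \<in> \<S>" "open D" "connected D" "D \<subseteq> slice_embed J -` (Q \<inter> \<Omega>)" "\<xi> \<in> D"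
      "\<xi> islimpt D \<inter> slice_embed J -` E" for J D \<xi>
  proof
    fix z assume z: "z \<in> D"
    have "f (slice_embed J z) = g (slice_embed J z)"
      if "slice_regular_on f \<Omega>" "slice_regular_on g Q" "\<forall>q\<in>P. f q = g q" for f g
      by (rule slice_regular_identity
          [OF that(1,2) \<open>J \<in> \<S>\<close> \<open>open D\<close> \<open>connected D\<close> _ _ \<open>\<xi> \<in> D\<close>
            \<open>\<xi> islimpt D \<inter> slice_embed J -` E\<close> _ z])
        (use that \<open>D \<subseteq> slice_embed J -` (Q \<inter> \<Omega>)\<close> in \<open>auto simp: E_def\<close>)
    then show "z \<in> slice_embed J -` E"
      using z \<open>D \<subseteq> slice_embed J -` (Q \<inter> \<Omega>)\<close> by (auto simp: E_def)
  qed
  have vimage_A: "slice_embed J -` A = interior (slice_embed J -` E)" if J: "J \<in> \<S>" for J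
  proof
    show "interior (slice_embed J -` E) \<subseteq> slice_embed J -` A"
      using J by (auto simp: A_def)
    show "slice_embed J -` A \<subseteq> interior (slice_embed J -` E)"
    proof
      fix z assume "z \<in> slice_embed J -` A"
      then obtain K w where K: "K \<in> \<S>" "slice_embed J z = slice_embed K w"
        and w: "w \<in> interior (slice_embed K -` E)"
        by (auto simp: A_def)
      then obtain e where e: "e > 0" "ball w e \<subseteq> slice_embed K -` E"
        by (meson mem_interior)
      from J K show "z \<in> interior (slice_embed J -` E)"
      proof (cases rule: slice_embed_eq_cases)
        \<comment> \<open>At a real point the two discs may lie in different slices, but they share
          a real interval. Agreement on it accumulates at \<open>z\<close> and spreads over the disc
          in the slice of \<open>J\<close>.\<close>
        case 1
        have "z \<in> slice_embed J -` (Q \<inter> \<Omega>)"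
          using K e centre_in_ball [of w e] by (auto simp: E_def subset_iff)
        moreover have "open (slice_embed J -` (Q \<inter> \<Omega>))"
          using open_Q [OF J] open_Om [OF J] by (simp add: vimage_Int open_Int)
        ultimately obtain d where d: "d > 0" "ball z d \<subseteq> slice_embed J -` (Q \<inter> \<Omega>)"
          by (meson openE)
        have "z islimpt ball z d \<inter> slice_embed J -` E"
          unfolding islimpt_approachable
        proof (intro allI impI)
          fix \<epsilon> :: real assume "\<epsilon> > 0"
          \<comment> \<open>The shift is real, so that \<open>x\<close> stays on both slices, and
            halving the minimum keeps it strictly within all three radii.\<close>
          define x where "x = z + of_real (min \<epsilon> (min d e) / 2)"
          have x: "dist x z < \<epsilon>" "dist x z < d" "dist x z < e" "x \<noteq> z" "Im x = 0"
            using \<open>\<epsilon> > 0\<close> d e 1 by (auto simp: x_def dist_norm min_def)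
          then have "x \<in> slice_embed K -` E"
            using e(2) 1 by (intro subsetD [OF e(2)]) (simp add: dist_commute)
          with x have "x \<in> ball z d \<inter> slice_embed J -` E"
            by (simp add: slice_embed_real dist_commute)
          with x show "\<exists>x'\<in>ball z d \<inter> slice_embed J -` E. x' \<noteq> z \<and> dist x' z < \<epsilon>" by blast
        qed
        then have "ball z d \<subseteq> slice_embed J -` E"
          using d J by (intro spread [of _ _ z]) auto
        then show ?thesis using d mem_interior by blast
      next
        case 2
        then show ?thesis using w by simp
      next
        case 3
        have "ball z e \<subseteq> slice_embed J -` E"
        proof
          fix x assume "x \<in> ball z e"
          then have "cnj x \<in> ball w e"
            using 3 by (simp add: dist_norm flip: complex_cnj_diff)
          then show "x \<in> slice_embed J -` E"
            using e 3 by (auto simp: slice_embed_uminus)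
        qed
        then show ?thesis using e mem_interior by blast
      qed
    qed
  qed
  \<comment> \<open>Relative closedness in \<open>Q\<close>, slice by slice; this is the half of the
    clopen argument that needs the singular functions.\<close>
  have closed_A: "\<zeta> \<in> slice_embed J -` A"
    if J: "J \<in> \<S>" and \<zeta>: "\<zeta> \<in> closure (slice_embed J -` A)" "\<zeta> \<in> slice_embed J -` Q" for J \<zeta>
  proof -
    let ?W = "slice_embed J -` \<Omega>"
    obtain e where e: "e > 0" "ball \<zeta> e \<subseteq> slice_embed J -` Q"
      using \<zeta>(2) open_Q [OF J] by (meson openE)
    obtain \<xi> where \<xi>: "\<xi> \<in> ball \<zeta> e" "\<xi> \<in> interior (slice_embed J -` E)"
      using \<zeta>(1) e unfolding vimage_A [OF J] closure_approachable by (auto simp: dist_commute)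
    have sub: "interior (slice_embed J -` E) \<subseteq> ?W"
      using interior_subset by (fastforce simp: E_def)
    have BE: "ball \<zeta> e \<inter> ?W \<subseteq> slice_embed J -` E"
    proof (rule spread [OF J])
      show "open (ball \<zeta> e \<inter> ?W)" using open_Om [OF J] by auto
      show "connected (ball \<zeta> e \<inter> ?W)"
        by (intro convex_connected convex_Int convex_ball conv J)
      show "ball \<zeta> e \<inter> ?W \<subseteq> slice_embed J -` (Q \<inter> \<Omega>)" using e by auto
      show "\<xi> \<in> ball \<zeta> e \<inter> ?W" using \<xi> sub by auto
      have "\<xi> \<in> interior (ball \<zeta> e \<inter> ?W \<inter> slice_embed J -` E)"
        using \<xi> sub open_Om [OF J] by (auto simp: interior_open)
      then show "\<xi> islimpt ball \<zeta> e \<inter> ?W \<inter> slice_embed J -` E"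
        by (rule interior_limit_point)
    qed
    \<comment> \<open>Otherwise \<open>\<zeta>\<close> is a frontier point, and the singular
      \<open>f\<close> agrees near it with some \<open>g\<close> that is regular on \<open>Q\<close>
      and therefore continuous at \<open>\<zeta>\<close>.\<close>
    have "\<zeta> \<in> ?W"
    proof (rule ccontr)
      assume notin: "\<zeta> \<notin> ?W"
      have "\<zeta> \<in> closure ?W"
        using \<zeta>(1) closure_mono [OF sub] by (auto simp: vimage_A [OF J])
      then have "\<zeta> \<in> frontier ?W"
        using notin open_Om [OF J] by (simp add: frontier_def interior_open)
      then obtain f where f: "slice_regular_on f \<Omega>"
        "\<And>l. \<not> ((\<lambda>z. f (slice_embed J z)) \<longlongrightarrow> l) (at \<zeta> within ?W)"
        using bdry [OF J] by blast
      obtain g where g: "slice_regular_on g Q" "\<forall>q\<in>P. f q = g q" using ext [OF f(1)] by blast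
      obtain a where "((\<lambda>z. g (slice_embed J z)) has_derivative (\<lambda>h. slice_embed J h * a)) (at \<zeta>)"
        using g(1) J \<zeta>(2) unfolding slice_regular_on_iff by meson
      then have "((\<lambda>z. g (slice_embed J z)) \<longlongrightarrow> g (slice_embed J \<zeta>)) (at \<zeta> within ?W)"
        using has_derivative_continuous continuous_at tendsto_within_subset by blast
      moreover have "eventually (\<lambda>z. f (slice_embed J z) = g (slice_embed J z)) (at \<zeta> within ?W)"
        unfolding eventually_at
      proof (intro exI [of _ e] conjI e(1) ballI impI)
        fix z assume "z \<in> ?W" "z \<noteq> \<zeta> \<and> dist z \<zeta> < e"
        then have "z \<in> slice_embed J -` E" using BE by (auto simp: dist_commute)
        then show "f (slice_embed J z) = g (slice_embed J z)"
          using f(1) g by (simp add: E_def)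
      qed
      ultimately show False
        using f(2) by (simp add: tendsto_cong)
    qed
    then have "\<zeta> \<in> ball \<zeta> e \<inter> ?W" using e by simp
    moreover have "open (ball \<zeta> e \<inter> ?W)" using open_Om [OF J] by auto
    ultimately show ?thesis
      unfolding vimage_A [OF J] using BE by (meson interiorI)
  qed
  have "slice_open A"
    by (simp add: slice_open_iff vimage_A)
  moreover have "slice_open (Q - A)"
  proof -
    have "slice_embed J -` (Q - A) = slice_embed J -` Q - closure (slice_embed J -` A)"
      if "J \<in> \<S>" for J
      using closed_A [OF that] closure_subset by blast
    then show ?thesis by (simp add: slice_open_iff open_Diff open_Q)
  qed
  moreover have "A \<subseteq> Q \<inter> \<Omega>"
    using interior_subset by (fastforce simp: A_def E_def)
  moreover have "P \<subseteq> A"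
  proof
    fix q assume "q \<in> P"
    obtain J z where J: "J \<in> \<S>" "q = slice_embed J z" by (rule ex_slice_embed)
    have "slice_embed J -` P \<subseteq> slice_embed J -` E"
      using P(3) by (auto simp: E_def)
    then have "z \<in> interior (slice_embed J -` E)"
      using \<open>q \<in> P\<close> J open_P by (intro interiorI) auto
    then show "q \<in> A" using J by (auto simp: A_def)
  qed
  \<comment> \<open>\<open>A\<close> and \<open>Q - A\<close> would disconnect \<open>Q\<close>: the
    first contains the nonempty \<open>P\<close>, the second is nonempty because \<open>A\<close>
    lies in \<open>\<Omega>\<close> and \<open>Q\<close> does not.\<close>
  ultimately show False
    using P(2) Q(2,3) unfolding slice_connected_def connectedin openin_slice_topology by blast
qed

section \<open>The \<open>\<sigma>\<close>-ball in slice coordinates\<close>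

text \<open>For nonreal points on different slices, the sum of the absolute imaginary parts is the
  larger of \<open>\<bar>Im z - Im w\<bar>\<close> and \<open>\<bar>Im z + Im w\<bar>\<close>, which
  produces the maximum. If one point is real, it lies on every slice and the two distances
  coincide.\<close>

lemma sigma_dist_slice_embed:
  assumes I: "I \<in> \<S>" and J: "J \<in> \<S>"
  shows "sigma_dist (slice_embed I z) (slice_embed J w) =
    (if J = I then dist z w else if J = - I then dist z (cnj w)
     else max (dist z w) (dist z (cnj w)))"
proof -
  let ?c = "\<exists>K\<in>\<S>. slice_embed J w \<in> slice K \<and> slice_embed I z \<in> slice K"
  have sd: "sigma_dist (slice_embed I z) (slice_embed J w) =
      (if ?c then dist (slice_embed I z) (slice_embed J w)
       else sqrt ((Re z - Re w)\<^sup>2 + (\<bar>Im z\<bar> + \<bar>Im w\<bar>)\<^sup>2))"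
    unfolding sigma_dist_def
    by (rule if_cong) (simp_all add: dist_norm slice_embed_sel I J)
  consider "J = I" | "J \<noteq> I" "J = - I" | "J \<noteq> I" "J \<noteq> - I" "Im z = 0"
    | "J \<noteq> I" "J \<noteq> - I" "Im w = 0" | "J \<noteq> I" "J \<noteq> - I" "Im z \<noteq> 0" "Im w \<noteq> 0"
    by blast
  then show ?thesis
  proof cases
    case 1
    then show ?thesis using I unfolding sd by (auto simp: dist_slice_embed slice_eq_range)
  next
    case 2
    then show ?thesis
      using I unfolding sd by (auto simp: dist_slice_embed slice_eq_range slice_embed_uminus)
  next
    case 3
    then have "slice_embed I z = slice_embed J z" by (simp add: slice_embed_real)
    moreover have "dist z (cnj w) = dist z w"
      using 3 by (simp add: dist_norm cmod_def)
    ultimately show ?thesis using 3 J unfolding sd by (auto simp: dist_slice_embed slice_eq_range)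
  next
    case 4
    then have "slice_embed J w = slice_embed I w" by (simp add: slice_embed_real)
    moreover have "dist z (cnj w) = dist z w"
      using 4 by (simp add: dist_norm cmod_def)
    ultimately show ?thesis using 4 I unfolding sd by (auto simp: dist_slice_embed slice_eq_range)
  next
    case 5
    have nc: "\<not> ?c"
    proof
      assume ?c
      then obtain K a b where K: "K \<in> \<S>" "slice_embed J w = slice_embed K a"
        "slice_embed I z = slice_embed K b"
        by (auto simp: slice_eq_range)
      from J K(1,2) have "J = K \<or> J = - K"
        by (rule slice_embed_eq_cases) (use 5 in auto)
      moreover from I K(1,3) have "I = K \<or> I = - K"
        by (rule slice_embed_eq_cases) (use 5 in auto)
      ultimately show False using 5 by auto
    qed
    have "sqrt ((Re z - Re w)\<^sup>2 + (\<bar>Im z\<bar> + \<bar>Im w\<bar>)\<^sup>2) = max (dist z w) (dist z (cnj w))"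
    proof (cases "Im z * Im w \<ge> 0")
      case True
      then have "\<bar>Im z\<bar> + \<bar>Im w\<bar> = \<bar>Im z + Im w\<bar>"
        by (auto simp: zero_le_mult_iff abs_if)
      moreover have "dist z w \<le> dist z (cnj w)"
        using True by (simp add: dist_norm cmod_def power2_eq_square algebra_simps)
      ultimately show ?thesis by (simp add: dist_norm cmod_def)
    next
      case False
      then have "\<bar>Im z\<bar> + \<bar>Im w\<bar> = \<bar>Im z - Im w\<bar>"
        by (auto simp: not_le mult_less_0_iff abs_if)
      moreover have "dist z (cnj w) \<le> dist z w"
        using False by (simp add: dist_norm cmod_def power2_eq_square algebra_simps)
      ultimately show ?thesis by (simp add: dist_norm cmod_def)
    qed
    then show ?thesis
      unfolding sd if_not_P [OF nc] using 5 by simp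
  qed
qed

lemma vimage_sigma_ball:
  assumes "I \<in> \<S>" "J \<in> \<S>"
  shows "slice_embed J -` sigma_ball (slice_embed I z) r =
    (if J = I then ball z r else if J = - I then ball (cnj z) r
     else ball z r \<inter> ball (cnj z) r)"
proof -
  have "dist z (cnj w) = dist (cnj z) w" for w
    by (metis complex_cnj_cnj complex_cnj_diff complex_mod_cnj dist_norm)
  then show ?thesis
    using assms by (auto simp: sigma_ball_def sigma_dist_slice_embed)
qed

section \<open>The singular function and its behaviour at the pole\<close>

text \<open>
  With \<open>w = slice_embed I \<omega>\<close>, this is the \<open>*\<close>-inverse of \<open>q - w\<close>, given by
  \<open>(q\<^sup>2 - 2 Re(w) q + |w|\<^sup>2)\<^sup>-\<^sup>1 (q - w')\<close> with the conjugate \<open>w'\<close> of \<open>w\<close>. On the slice of \<open>I\<close> the cancelled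
  form is needed, because \<open>w'\<close> may lie in the ball and the quotient is the junk value 0 there.
\<close>

definition star_inverse :: "quat \<Rightarrow> complex \<Rightarrow> quat \<Rightarrow> quat" where
  "star_inverse I \<omega> q =
     (if q \<in> slice I then inverse (q - slice_embed I \<omega>)
      else inverse (q\<^sup>2 - of_real (2 * Re \<omega>) * q + of_real ((cmod \<omega>)\<^sup>2)) * (q - slice_embed I (cnj \<omega>)))"

lemma quadratic_factor:
  fixes z \<omega> :: complex
  shows "z\<^sup>2 - of_real (2 * Re \<omega>) * z + of_real ((cmod \<omega>)\<^sup>2) = (z - \<omega>) * (z - cnj \<omega>)"
  by (simp add: complex_eq_iff cmod_def power2_eq_square algebra_simps)

text \<open>The coefficients are real, so every slice embedding carries the complex polynomial to
  the same quaternionic one.\<close>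

lemma slice_embed_quadratic:
  assumes "J \<in> \<S>"
  shows "(slice_embed J z)\<^sup>2 - of_real (2 * Re \<omega>) * slice_embed J z + of_real ((cmod \<omega>)\<^sup>2)
    = slice_embed J ((z - \<omega>) * (z - cnj \<omega>))"
  unfolding quadratic_factor [symmetric] power2_eq_square slice_embed_add slice_embed_diff
    slice_embed_mult [OF assms] slice_embed_of_real ..

lemma slice_embed_mem_slice:
  assumes "I \<in> \<S>" "J \<in> \<S>"
  shows "slice_embed J z \<in> slice I \<longleftrightarrow> J = I \<or> J = - I \<or> Im z = 0"
proof
  assume "slice_embed J z \<in> slice I"
  then obtain w where "slice_embed J z = slice_embed I w" by (auto simp: slice_eq_range)
  with assms(2,1) show "J = I \<or> J = - I \<or> Im z = 0"
    by (rule slice_embed_eq_cases) auto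
next
  assume "J = I \<or> J = - I \<or> Im z = 0"
  then consider "J = I" | "J = - I" | "Im z = 0" by blast
  then show "slice_embed J z \<in> slice I"
  proof cases
    case 3
    then have "slice_embed J z = slice_embed I z" by (simp add: slice_embed_real)
    then show ?thesis by (simp add: slice_eq_range)
  qed (auto simp: slice_eq_range slice_embed_uminus)
qed

lemma star_inverse_slice: "star_inverse I \<omega> (slice_embed I z) = inverse (slice_embed I (z - \<omega>))"
  by (simp add: star_inverse_def slice_eq_range slice_embed_diff)

text \<open>At real points the definition takes the cancelled branch even on the slice of
  \<open>J\<close>. There all terms lie in the commutative slice of \<open>I\<close> and
  \<open>z - cnj \<omega>\<close> cancels, so one formula is valid across the real axis.\<close>

lemma star_inverse_off_slice:
  assumes I: "I \<in> \<S>" and J: "J \<in> \<S>" "J \<noteq> I" "J \<noteq> - I" and z: "z \<noteq> \<omega>" "z \<noteq> cnj \<omega>"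
  shows "star_inverse I \<omega> (slice_embed J z) =
    inverse (slice_embed J ((z - \<omega>) * (z - cnj \<omega>))) * (slice_embed J z - slice_embed I (cnj \<omega>))"
proof (cases "Im z = 0")
  case True
  then have eq: "slice_embed J z = slice_embed I z"
    by (simp add: slice_embed_real)
  have "Im ((z - \<omega>) * (z - cnj \<omega>)) = 0" using True by simp
  then have eq2: "slice_embed J ((z - \<omega>) * (z - cnj \<omega>)) = slice_embed I ((z - \<omega>) * (z - cnj \<omega>))"
    by (simp only: slice_embed_real)
  have "inverse (slice_embed J ((z - \<omega>) * (z - cnj \<omega>))) * (slice_embed J z - slice_embed I (cnj \<omega>))
      = slice_embed I (inverse ((z - \<omega>) * (z - cnj \<omega>)) * (z - cnj \<omega>))"
    by (simp only: eq eq2 flip: slice_embed_mult [OF I] slice_embed_inverse [OF I] slice_embed_diff)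
  also have "inverse ((z - \<omega>) * (z - cnj \<omega>)) * (z - cnj \<omega>) = inverse (z - \<omega>)"
    using z by simp
  finally show ?thesis
    by (simp add: eq star_inverse_slice slice_embed_inverse [OF I])
next
  case False
  then show ?thesis
    using slice_embed_mem_slice [OF I J(1), of z] J
    by (simp add: star_inverse_def flip: slice_embed_quadratic)
qed

text \<open>Clearing denominators gives a single identity for all slices, from which limits at the
  roots of the quadratic can be read off.\<close>

lemma star_inverse_quadratic:
  assumes I: "I \<in> \<S>" and J: "J \<in> \<S>" and z: "z \<noteq> \<omega>" "z \<noteq> cnj \<omega>"
  shows "slice_embed J ((z - \<omega>) * (z - cnj \<omega>)) * star_inverse I \<omega> (slice_embed J z)
    = slice_embed J z - slice_embed I (cnj \<omega>)"
proof -
  have *: "slice_embed I ((z - \<omega>) * (z - cnj \<omega>)) * star_inverse I \<omega> (slice_embed I z)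
      = slice_embed I z - slice_embed I (cnj \<omega>)" if "z \<noteq> \<omega>" for z
  proof -
    have "(z - \<omega>) * (z - cnj \<omega>) * inverse (z - \<omega>) = z - cnj \<omega>"
      using that by (simp add: field_simps)
    then show ?thesis
      by (simp only: star_inverse_slice flip: slice_embed_inverse [OF I]
          slice_embed_mult [OF I] slice_embed_diff)
  qed
  consider "J = I" | "J = - I" | "J \<noteq> I" "J \<noteq> - I" by blast
  then show ?thesis
  proof cases
    case 1
    then show ?thesis using * z by simp
  next
    case 2
    have nz: "cnj z \<noteq> \<omega>" using z by auto
    have eq: "cnj ((z - \<omega>) * (z - cnj \<omega>)) = (cnj z - \<omega>) * (cnj z - cnj \<omega>)"
      by (simp add: mult.commute)
    show ?thesis
      unfolding 2 slice_embed_uminus eq by (rule * [OF nz])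
  next
    case 3
    have nz: "slice_embed J ((z - \<omega>) * (z - cnj \<omega>)) \<noteq> 0"
      using z slice_embed_eq_iff [OF J, of _ 0] by simp
    show ?thesis
      unfolding star_inverse_off_slice [OF I J 3 z]
      by (simp only: right_inverse [OF nz] mult_1_left flip: mult.assoc)
  qed
qed

text \<open>On the slice of \<open>I\<close> the only singularity is
  \<open>slice_embed I \<omega>\<close>, seen at \<open>cnj \<omega>\<close> in the coordinate of
  \<open>- I\<close>. On the other slices both roots of the quadratic have to be avoided, whence
  \<open>off\<close>.\<close>

lemma slice_regular_star_inverse:
  assumes op: "slice_open \<Omega>" and I: "I \<in> \<S>" and \<omega>: "slice_embed I \<omega> \<notin> \<Omega>"
    and off: "\<And>J z. J \<in> \<S> \<Longrightarrow> J \<noteq> I \<Longrightarrow> J \<noteq> - I \<Longrightarrow> slice_embed J z \<in> \<Omega> \<Longrightarrow>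
      z \<noteq> \<omega> \<and> z \<noteq> cnj \<omega>"
  shows "slice_regular_on (star_inverse I \<omega>) \<Omega>"
proof (rule slice_regular_onI [OF op])
  fix J assume J: "J \<in> \<S>"
  let ?W = "slice_embed J -` \<Omega>"
  let ?P = "\<lambda>u v a. u holomorphic_on ?W \<and> v holomorphic_on ?W \<and>
      (\<forall>z\<in>?W. star_inverse I \<omega> (slice_embed J z) = slice_embed J (u z) + slice_embed J (v z) * a)"
  consider "J = I" | "J = - I" | "J \<noteq> I" "J \<noteq> - I" by blast
  then show "\<exists>u v a. ?P u v a"
  proof cases
    case 1
    have "?P (\<lambda>z. inverse (z - \<omega>)) (\<lambda>z. 0) 0"
      using \<omega> 1
      by (auto intro!: holomorphic_intros simp: star_inverse_slice slice_embed_inverse [OF I])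
    then show ?thesis by blast
  next
    case 2
    have "cnj \<omega> \<notin> ?W" using \<omega> 2 by (simp add: slice_embed_uminus)
    moreover have "star_inverse I \<omega> (slice_embed J z) = slice_embed J (inverse (z - cnj \<omega>))" for z
      by (simp add: 2 slice_embed_uminus star_inverse_slice slice_embed_inverse [OF I])
    ultimately have "?P (\<lambda>z. inverse (z - cnj \<omega>)) (\<lambda>z. 0) 0"
      by (auto intro!: holomorphic_intros)
    then show ?thesis by blast
  next
    case 3
    let ?d = "\<lambda>z. inverse ((z - \<omega>) * (z - cnj \<omega>))"
    have nz: "z \<noteq> \<omega> \<and> z \<noteq> cnj \<omega>" if "z \<in> ?W" for z
      using off [OF J 3] that by simp
    \<comment> \<open>The constant \<open>slice_embed I (cnj \<omega>)\<close> need not commute with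
      the slice of \<open>J\<close>; it stands on the right and becomes \<open>a\<close>.\<close>
    have "star_inverse I \<omega> (slice_embed J z)
        = slice_embed J (?d z * z) + slice_embed J (- ?d z) * slice_embed I (cnj \<omega>)" if "z \<in> ?W" for z
    proof -
      have "slice_embed J (- w) = - slice_embed J w" for w
        by (simp add: slice_embed_def)
      then show ?thesis
        unfolding slice_embed_mult [OF J, of "?d z"]
        using star_inverse_off_slice [OF I J 3] nz [OF that]
        by (simp add: right_diff_distrib slice_embed_inverse [OF J] del: inverse_mult_distrib)
    qed
    moreover have "(\<lambda>z. ?d z * z) holomorphic_on ?W" "(\<lambda>z. - ?d z) holomorphic_on ?W"
      using nz by (auto intro!: holomorphic_intros)
    ultimately show ?thesis by blast
  qed
qed

text \<open>A limit would force the product with the quadratic to tend to 0, whereas by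
  \<open>star_inverse_quadratic\<close> and \<open>neq\<close> it tends to a nonzero value when
  \<open>\<zeta>\<close> is not real.\<close>

lemma star_inverse_no_limit:
  assumes I: "I \<in> \<S>" and J: "J \<in> \<S>" and \<zeta>: "\<zeta> = \<omega> \<or> \<zeta> = cnj \<omega>"
    and neq: "Im \<zeta> \<noteq> 0 \<Longrightarrow> slice_embed J \<zeta> \<noteq> slice_embed I (cnj \<omega>)"
    and lim: "at \<zeta> within W \<noteq> bot"
  shows "\<not> ((\<lambda>z. star_inverse I \<omega> (slice_embed J z)) \<longlongrightarrow> l) (at \<zeta> within W)"
proof
  let ?s = "\<lambda>z. star_inverse I \<omega> (slice_embed J z)"
  assume s: "(?s \<longlongrightarrow> l) (at \<zeta> within W)"
  note lin = bounded_linear.tendsto [OF bounded_linear_slice_embed [OF J]]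
  have ev: "eventually (\<lambda>z. z \<noteq> \<omega> \<and> z \<noteq> cnj \<omega>) (at \<zeta> within W)"
    by (intro eventually_conj eventually_neq_at_within)
  show False
  proof (cases "Im \<zeta> = 0")
    \<comment> \<open>At a real point the numerator vanishes as well. A single linear factor is used
      instead: its product with the function is 1, yet would have to tend to 0.\<close>
    case True
    then have real: "cnj \<omega> = \<omega>" "\<zeta> = \<omega>" and eq: "slice_embed I \<omega> = slice_embed J \<omega>"
      using \<zeta> by (auto simp: complex_eq_iff slice_embed_real)
    have "((\<lambda>z. slice_embed J (z - \<omega>) * ?s z) \<longlongrightarrow> slice_embed J (\<zeta> - \<omega>) * l) (at \<zeta> within W)"
      by (intro tendsto_intros lin s)
    moreover have "eventually (\<lambda>z. slice_embed J (z - \<omega>) * ?s z = 1) (at \<zeta> within W)"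
      using ev
    proof eventually_elim
      case (elim z)
      then have "slice_embed J (z - \<omega>) * (slice_embed J (z - \<omega>) * ?s z) = slice_embed J (z - \<omega>) * 1"
        using star_inverse_quadratic [OF I J, of z \<omega>]
        by (simp add: real eq slice_embed_mult [OF J] mult.assoc flip: slice_embed_diff)
      moreover have "slice_embed J (z - \<omega>) \<noteq> 0"
        using elim slice_embed_eq_iff [OF J, of _ 0] by simp
      ultimately show ?case using mult_left_cancel by blast
    qed
    ultimately have "((\<lambda>z. 1) \<longlongrightarrow> slice_embed J (\<zeta> - \<omega>) * l) (at \<zeta> within W)"
      by (rule Lim_transform_eventually)
    then show False
      using lim by (simp add: real tendsto_const_iff)
  next
    case False
    let ?d = "\<lambda>z. slice_embed J ((z - \<omega>) * (z - cnj \<omega>))"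
    have "?d \<zeta> = 0" using \<zeta> by auto
    moreover have "((\<lambda>z. ?d z * ?s z) \<longlongrightarrow> ?d \<zeta> * l) (at \<zeta> within W)"
      by (intro tendsto_intros lin s)
    ultimately have "((\<lambda>z. ?d z * ?s z) \<longlongrightarrow> 0) (at \<zeta> within W)"
      by simp
    moreover have "eventually (\<lambda>z. ?d z * ?s z = slice_embed J z - slice_embed I (cnj \<omega>)) (at \<zeta> within W)"
      using ev by eventually_elim (use star_inverse_quadratic [OF I J] in blast)
    ultimately have "((\<lambda>z. slice_embed J z - slice_embed I (cnj \<omega>)) \<longlongrightarrow> 0) (at \<zeta> within W)"
      by (rule Lim_transform_eventually)
    moreover have "((\<lambda>z. slice_embed J z - slice_embed I (cnj \<omega>)) \<longlongrightarrow>
        slice_embed J \<zeta> - slice_embed I (cnj \<omega>)) (at \<zeta> within W)"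
      by (intro tendsto_intros lin)
    ultimately have "slice_embed J \<zeta> - slice_embed I (cnj \<omega>) = 0"
      using tendsto_unique [OF lim] by blast
    then show False using neq [OF False] by simp
  qed
qed

section \<open>Choice of the pole for each frontier point\<close>

theorem proposition9p6:
  fixes p :: quat and r :: real
  assumes "r > 0"
  shows "domain_of_slice_regularity (sigma_ball p r)"
proof -
  obtain I z0 where I: "I \<in> \<S>" and p: "p = slice_embed I z0"
    by (rule ex_slice_embed)
  note W = vimage_sigma_ball [OF I, of _ z0 r, folded p]
  have op: "slice_open (sigma_ball p r)"
    by (auto simp: slice_open_iff W)
  have cnj_dist: "dist (cnj z) (cnj w) = dist z w" for z w
    by (simp add: dist_norm flip: complex_cnj_diff)
  show ?thesis
  proof (rule domain_of_slice_regularityI [OF op])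
    show "convex (slice_embed J -` sigma_ball p r)" if "J \<in> \<S>" for J
      by (simp add: W [OF that] convex_Int)
    fix J \<zeta> assume J: "J \<in> \<S>" and fr: "\<zeta> \<in> frontier (slice_embed J -` sigma_ball p r)"
    \<comment> \<open>The pole is \<open>\<zeta>\<close> for \<open>J = I\<close> and its conjugate
      for \<open>J = - I\<close>. On other slices the frontier of the intersection lies in the union
      of the two circles, so one of the two choices has distance \<open>r\<close> from
      \<open>z0\<close>; there \<open>neq\<close> holds because the slices share only real
      points.\<close>
    obtain \<omega> where \<omega>: "dist z0 \<omega> = r" "\<zeta> = \<omega> \<or> \<zeta> = cnj \<omega>"
      and neq: "Im \<zeta> \<noteq> 0 \<Longrightarrow> slice_embed J \<zeta> \<noteq> slice_embed I (cnj \<omega>)"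
    proof -
      consider "J = I" | "J \<noteq> I" "J = - I" | "J \<noteq> I" "J \<noteq> - I" by blast
      then show thesis
      proof cases
        case 1
        then have "dist z0 \<zeta> = r" using fr assms by (simp add: W [OF I])
        then show thesis
        proof (rule that)
          show "slice_embed J \<zeta> \<noteq> slice_embed I (cnj \<zeta>)" if "Im \<zeta> \<noteq> 0"
            using that unfolding 1 slice_embed_eq_iff [OF I] by (simp add: complex_eq_iff)
        qed simp
      next
        case 2
        then have "dist z0 (cnj \<zeta>) = r"
          using fr assms cnj_dist [of z0 "cnj \<zeta>"] by (simp add: W [OF imag_units_uminus [OF I]])
        then show thesis
        proof (rule that)
          show "slice_embed J \<zeta> \<noteq> slice_embed I (cnj (cnj \<zeta>))" if "Im \<zeta> \<noteq> 0"
            using that unfolding 2(2) slice_embed_uminus slice_embed_eq_iff [OF I]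
            by (simp add: complex_eq_iff)
        qed simp
      next
        case 3
        then have "\<zeta> \<in> frontier (ball z0 r) \<union> frontier (ball (cnj z0) r)"
          using fr frontier_Int_subset by (auto simp: W [OF J])
        then have "dist z0 \<zeta> = r \<or> dist z0 (cnj \<zeta>) = r"
          using assms cnj_dist [of z0 "cnj \<zeta>"] by auto
        moreover have neq: "slice_embed J \<zeta> \<noteq> slice_embed I w" if "Im \<zeta> \<noteq> 0" for w
          using slice_embed_eq_cases [OF J I, of \<zeta> w] 3 that by blast
        ultimately show thesis
          using that [OF _ _ neq] complex_cnj_cnj by metis
      qed
    qed
    have reg: "slice_regular_on (star_inverse I \<omega>) (sigma_ball p r)"
    proof (rule slice_regular_star_inverse [OF op I])
      show "slice_embed I \<omega> \<notin> sigma_ball p r"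
        using \<omega>(1) W [OF I] by (simp add: set_eq_iff)
      show "z \<noteq> \<omega> \<and> z \<noteq> cnj \<omega>"
        if "K \<in> \<S>" "K \<noteq> I" "K \<noteq> - I" "slice_embed K z \<in> sigma_ball p r" for K z
      proof -
        \<comment> \<open>On these slices the ball is contained in both discs, while
          \<open>\<omega>\<close> and its conjugate each lie on one bounding circle.\<close>
        have "dist z0 z < r" "dist (cnj z0) z < r"
          using W [OF that(1)] that(2-) by (simp_all add: set_eq_iff)
        then show ?thesis using \<omega>(1) cnj_dist [of z0 \<omega>] by auto
      qed
    qed
    \<comment> \<open>Uniqueness of limits needs a nontrivial filter; the slice is open and so omits
      its frontier point \<open>\<zeta>\<close>, which is therefore a limit point.\<close>
    have lim: "at \<zeta> within slice_embed J -` sigma_ball p r \<noteq> bot"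
    proof -
      have "open (slice_embed J -` sigma_ball p r)"
        using op J by (simp add: slice_open_iff)
      then have "\<zeta> islimpt slice_embed J -` sigma_ball p r"
        using fr by (auto simp: frontier_def interior_open closure_def)
      then show ?thesis by (simp add: trivial_limit_within)
    qed
    show "\<exists>f. slice_regular_on f (sigma_ball p r) \<and>
        (\<forall>l. \<not> ((\<lambda>z. f (slice_embed J z)) \<longlongrightarrow> l) (at \<zeta> within slice_embed J -` sigma_ball p r))"
      using reg star_inverse_no_limit [OF I J \<omega>(2) neq lim] by (intro exI conjI allI) assumption+
  qed
qed

end
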